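(* Let $0<\alpha<1$, let $x>0$, and let $f:[0,\infty)\to\mathbb{R}$ be a function. Then $f$ has a conformable fractional derivative of order $\alpha$ at $x$, i.e. the limit $$T_{\alpha}f(x)=\lim_{\epsilon\to 0}\frac{f(x+\epsilon x^{1-\alpha})-f(x)}{\epsilon}$$ exists (in $\mathbb{R}$), if and only if $f$ is differentiable at $x$ in the classical sense; and in this case $$T_{\alpha}f(x)=x^{1-\alpha}f'(x).$$
   Context: For $0<\alpha<1$, a function $f:[0,\infty)\to\mathbb{R}$ and a point $x>0$, the conformable fractional derivative of order $\alpha$ of $f$ at $x$ is $T_{\alpha}f(x):=\lim_{\epsilon\to 0}\frac{f(x+\epsilon x^{1-\alpha})-f(x)}{\epsilon}$, provided this (two-sided, finite) limit exists; for $|\epsilon|$ small the argument $x+\epsilon x^{1-\alpha}$ lies in the domain of $f$. No regularity of $f$ is assumed. *)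

theory Defs
  imports "HOL-Analysis.Analysis"
begin

(* A function on [0,oo) is represented by a total function real => real.  All notions are
   used only at points x > 0, where they do not depend on the values at negative arguments. *)

definition conformable_quotient :: "real \<Rightarrow> (real \<Rightarrow> real) \<Rightarrow> real \<Rightarrow> real \<Rightarrow> real"
  where "conformable_quotient \<alpha> f x = (\<lambda>\<epsilon>. (f (x + \<epsilon> * x powr (1 - \<alpha>)) - f x) / \<epsilon>)"

definition conformable_differentiable :: "real \<Rightarrow> (real \<Rightarrow> real) \<Rightarrow> real \<Rightarrow> bool"
  where "conformable_differentiable \<alpha> f x \<longleftrightarrow> (\<exists>L. (conformable_quotient \<alpha> f x \<longlongrightarrow> L) (at 0))"

(* Meaningful only if conformable_differentiable holds; otherwise Lim is an unspecified value. *)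
definition conformable_deriv :: "real \<Rightarrow> (real \<Rightarrow> real) \<Rightarrow> real \<Rightarrow> real"
  where "conformable_deriv \<alpha> f x = Lim (at 0) (conformable_quotient \<alpha> f x)"

end

theory Submission
  imports Defs
begin

text \<open>Since \<open>x\<close> is fixed and positive, c = \<open>x powr (1 - \<alpha>)\<close>
  is a nonzero constant, and the conformable quotient is the ordinary difference quotient at 0 of t
  \<mapsto> f(x + t c). This function is f after an invertible affine change of variable, so the
  chain rule, used in both directions, transfers differentiability and multiplies the derivative by
  c. \<open>DERIV_scaled_shift_iff\<close> is this transfer;
  \<open>conformable_quotient_tendsto_iff\<close> restates it for the conformable limit.\<close>

lemma DERIV_scaled_shift_iff:
  fixes f :: "real \<Rightarrow> real"
  assumes "c \<noteq> 0"
  shows "((\<lambda>t. f (x + t * c)) has_real_derivative L) (at 0) \<longleftrightarrow>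
         (f has_real_derivative L / c) (at x)"
proof
  assume *: "((\<lambda>t. f (x + t * c)) has_real_derivative L) (at 0)"
  \<comment> \<open>The inverse of t \<mapsto> x + t c: composing with it recovers f from the
    rescaled function.\<close>
  have "((\<lambda>y. (y - x) / c) has_real_derivative 1 / c) (at x)"
    using assms by (auto intro!: derivative_eq_intros)
  with * have "((\<lambda>y. f (x + (y - x) / c * c)) has_real_derivative L * (1 / c)) (at x)"
    by (intro DERIV_chain2[where f = "\<lambda>t. f (x + t * c)" and g = "\<lambda>y. (y - x) / c"]) simp_all
  then show "(f has_real_derivative L / c) (at x)"
    using assms by simp
next
  assume *: "(f has_real_derivative L / c) (at x)"
  have "((\<lambda>t. x + t * c) has_real_derivative c) (at 0)"
    by (auto intro!: derivative_eq_intros)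
  with * have "((\<lambda>t. f (x + t * c)) has_real_derivative L / c * c) (at 0)"
    by (intro DERIV_chain2[where f = f]) simp_all
  then show "((\<lambda>t. f (x + t * c)) has_real_derivative L) (at 0)"
    using assms by simp
qed

text \<open>Keeping the value \<open>L\<close> explicit serves both halves of the theorem:
  quantifying over \<open>L\<close> gives the equivalence, and reading off \<open>L\<close> gives
  the formula.\<close>

lemma conformable_quotient_tendsto_iff:
  assumes "x > 0"
  shows "(conformable_quotient \<alpha> f x \<longlongrightarrow> L) (at 0) \<longleftrightarrow>
         (f has_real_derivative L / x powr (1 - \<alpha>)) (at x)"
proof -
  have "(conformable_quotient \<alpha> f x \<longlongrightarrow> L) (at 0) \<longleftrightarrow>
        ((\<lambda>t. f (x + t * x powr (1 - \<alpha>))) has_real_derivative L) (at 0)"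
    by (simp add: DERIV_def conformable_quotient_def)
  also have "\<dots> \<longleftrightarrow> (f has_real_derivative L / x powr (1 - \<alpha>)) (at x)"
    using assms by (intro DERIV_scaled_shift_iff) simp
  finally show ?thesis .
qed

theorem theorem1:
  fixes \<alpha> x :: real and f :: "real \<Rightarrow> real"
  assumes "0 < \<alpha>" and "\<alpha> < 1" and "x > 0"
  shows "(conformable_differentiable \<alpha> f x \<longleftrightarrow> f differentiable (at x)) \<and>
         (conformable_differentiable \<alpha> f x \<longrightarrow>
            conformable_deriv \<alpha> f x = x powr (1 - \<alpha>) * deriv f x)"
proof -
  define c where "c = x powr (1 - \<alpha>)"
  have c: "c \<noteq> 0"
    using \<open>x > 0\<close> by (simp add: c_def)
  have iff: "(conformable_quotient \<alpha> f x \<longlongrightarrow> L) (at 0) \<longleftrightarrow>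
      (f has_real_derivative L / c) (at x)" for L
    using conformable_quotient_tendsto_iff[OF \<open>x > 0\<close>] by (simp add: c_def)
  have "conformable_differentiable \<alpha> f x \<longleftrightarrow> (\<exists>D. (f has_real_derivative D) (at x))"
    unfolding conformable_differentiable_def iff
    \<comment> \<open>Every derivative D has the form L / c, with witness L = D * c.\<close>
    using c by (metis nonzero_mult_div_cancel_right)
  then have "conformable_differentiable \<alpha> f x \<longleftrightarrow> f differentiable (at x)"
    by (simp add: real_differentiable_def)
  moreover have "conformable_deriv \<alpha> f x = c * deriv f x"
    if "conformable_differentiable \<alpha> f x"
  proof -
    obtain L where L: "(conformable_quotient \<alpha> f x \<longlongrightarrow> L) (at 0)"
      using \<open>conformable_differentiable \<alpha> f x\<close> by (auto simp: conformable_differentiable_def)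
    then have "deriv f x = L / c"
      by (simp add: iff DERIV_imp_deriv)
    \<comment> \<open>0 is not isolated in the reals, so the limit is unique and \<open>Lim\<close>
      returns it.\<close>
    moreover have "conformable_deriv \<alpha> f x = L"
      unfolding conformable_deriv_def using L by (intro tendsto_Lim) simp_all
    ultimately show ?thesis
      using c by simp
  qed
  ultimately show ?thesis
    by (simp add: c_def)
qed

end
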